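(* The linear finite type (ordinary) CMC surfaces are characterized by the property that the canonical formal Killing field $\mathbf Y$ is stationary with respect to a higher-order symmetry. That is: an ordinary CMC surface is of linear finite type if and only if there exist $N\ge0$ and constants $\mathrm c_0,\dots,\mathrm c_N\in\mathbb C$, not all zero, such that the symmetry $\mathcal V=\sum_{i=0}^N\mathrm c_i\,\partial_{t_i}$ satisfies $\mathcal V(\mathbf Y)=0$ on the surface.
   Context: Let $\gamma$ be a real constant with $\gamma^2>0$. Ordinary CMC surfaces of constant mean curvature $\delta$ in a 3-dimensional Riemannian space form of constant curvature $\epsilon$ are considered, with $\gamma^2=\epsilon+\delta^2$, away from umbilics (where the Hopf differential vanishes). On such a surface (on its unitary frame bundle) let $\xi$ be the tautological unitary $(1,0)$-form, $\bar\xi$ its complex conjugate, $\rho$ the connection form, and $h_2\xi^2$ the Hopf differential, $h_2\ne0$, with a chosen square root $h_2^{1/2}$ (locally, or on a double cover). Then $$d\xi=\mathrm i\rho\wedge\xi,\quad d\rho=R\tfrac{\mathrm i}{2}\xi\wedge\bar\xi,\quad R=\gamma^2-h_2\bar h_2,\quad dh_j+\mathrm ijh_j\rho=h_{j+1}\xi+T_j\bar\xi\ (j\ge2),\quad T_2=0,$$ which defines the functions $h_j$ ($j\ge3$) successively (here $T_j$ is a polynomial in $h_2,\dots,h_{j-1},\bar h_2$). Put $z_j=h_2^{-j/2}h_j$. **Canonical formal Killing field.** Let $$\phi_\lambda=\begin{pmatrix}\frac{\mathrm i}{2}\rho&-\frac{\lambda}{2}\gamma\bar\xi-\frac{\lambda^{-1}}{2}h_2\xi\\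 \frac{\lambda}{2}\bar h_2\bar\xi+\frac{\lambda^{-1}}{2}\gamma\xi&-\frac{\mathrm i}{2}\rho\end{pmatrix}.$$ The canonical formal Killing field is $$\mathbf Y=\begin{pmatrix}-\mathrm i\mathbf a&2\mathbf c\\2\mathbf b&\mathrm i\mathbf a\end{pmatrix},\quad \mathbf a=\sum_{n\ge0}\lambda^{2n}a^{2n+1},\ \mathbf b=\sum_{n\ge0}\lambda^{2n+1}b^{2n+2},\ \mathbf c=\sum_{n\ge0}\lambda^{2n+1}c^{2n+2}$$ (superscripts on $a,b,c$ are indices), determined, as an expression on the infinite jet space, by $a^1=0$, $b^2=-\mathrm i\gamma h_2^{-1/2}$, $c^2=\mathrm ih_2^{1/2}$, $\det\mathbf Y=-4\gamma\lambda^2$ and $d\mathbf Y+[\phi_\lambda,\mathbf Y]=0$; the functions $a^{2n+1},h_2^{1/2}b^{2n+2},h_2^{-1/2}c^{2n+2}$ are universal polynomials in $z_3,z_4,\dots$ (e.g. $a^3=z_3$). Each $a^{2n+1}$, $n\ge1$, is a higher-order Jacobi field, i.e. lies in the kernel of the Jacobi operator $\partial_\xi\partial_{\bar\xi}+\frac12(\gamma^2+h_2\bar h_2)$. **Symmetries.** For $m\ge0$ let $U_m$ be the part of $\frac1{2\mathrm i}\lambda^{-2m-2}\mathbf Y$ of $\lambda$-degree $\le-1$. The CMC hierarchy gives commuting symmetry vector fields $\partial_{t_m}$ ($m\ge0$) on the formal moduli space of CMC surfaces, acting by $$\partial_{t_m}\mathbf Y=-[U_m,\mathbf Y],\qquad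 \partial_{t_m}h_2=-2h_2a^{2m+3}.$$ Here $\partial_{t_0}$ corresponds to $dt_0=-\frac12h_2^{1/2}\xi$. **Linear finite type.** A CMC surface is of linear finite type if a higher-order Jacobi field vanishes on it, i.e. if there are $N\ge0$ and constants $\mathrm c_0,\dots,\mathrm c_N\in\mathbb C$, not all zero, with $\sum_{i=0}^N\mathrm c_i a^{2i+3}=0$ on the surface. *)

theory Defs
  imports
    "HOL-Analysis.Analysis"
    "HOL-Computational_Algebra.Formal_Laurent_Series"
begin

subsection \<open>Smooth functions and differential forms on open subsets of \<open>\<real>\<^sup>3\<close>\<close>

text \<open>\<open>smooth_on V f\<close>: all iterated Frechet derivatives of \<open>f\<close> in constant directions exist on the
  open set \<open>V\<close> and are again Frechet differentiable.\<close>

primrec diff_upto :: "nat \<Rightarrow> 'a::real_normed_vector set \<Rightarrow> ('a \<Rightarrow> 'b::real_normed_vector) \<Rightarrow> bool" where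
  "diff_upto 0 V f \<longleftrightarrow> continuous_on V f"
| "diff_upto (Suc k) V f \<longleftrightarrow>
     (\<forall>x\<in>V. f differentiable (at x)) \<and>
     (\<forall>v. diff_upto k V (\<lambda>x. frechet_derivative f (at x) v))"

definition smooth_on :: "'a::real_normed_vector set \<Rightarrow> ('a \<Rightarrow> 'b::real_normed_vector) \<Rightarrow> bool" where
  "smooth_on V f \<longleftrightarrow> (\<forall>k. diff_upto k V f)"

type_synonym one_form = "real^3 \<Rightarrow> real^3 \<Rightarrow> real"
type_synonym two_form = "real^3 \<Rightarrow> real^3 \<Rightarrow> real^3 \<Rightarrow> real"

definition smooth_one_form :: "(real^3) set \<Rightarrow> one_form \<Rightarrow> bool" where
  "smooth_one_form V \<alpha> \<longleftrightarrow> (\<forall>x\<in>V. linear (\<alpha> x)) \<and> (\<forall>v. smooth_on V (\<lambda>x. \<alpha> x v))"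

definition wedge :: "one_form \<Rightarrow> one_form \<Rightarrow> two_form" where
  "wedge \<alpha> \<beta> x u v = \<alpha> x u * \<beta> x v - \<alpha> x v * \<beta> x u"

definition ext_deriv :: "one_form \<Rightarrow> two_form" where
  "ext_deriv \<alpha> x u v =
     frechet_derivative (\<lambda>y. \<alpha> y v) (at x) u - frechet_derivative (\<lambda>y. \<alpha> y u) (at x) v"

subsection \<open>CMC surfaces\<close>

text \<open>
  A CMC surface is described on its unitary frame bundle, or on a cover or an open part of it on
  which a square root of the Hopf coefficient has been chosen. The forms \<open>\<omega>\<^sup>i\<close>,
  \<open>\<omega>\<^sup>i\<^sub>j\<close> (\<open>1 \<le> i, j \<le> 3\<close>) are the pull-backs, to the adapted frames with \<open>e\<^sub>3\<close> normal to the
  surface, of the canonical forms and of the connection forms on the orthonormal frame bundle of a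
  Riemannian space form of constant curvature \<open>\<epsilon>\<close>; thus \<open>\<omega>\<^sup>3 = 0\<close>. The functions
  \<open>A\<^sub>a\<^sub>b\<close> are the coefficients of the second fundamental form and \<open>\<delta>\<close> is the mean curvature.

  A patch is the local expression of these data on an open subset \<open>pdom\<close> of
  \<open>\<real>\<^sup>3\<close>: \<open>pcof i\<close> is \<open>\<omega>\<^sup>i\<close>, \<open>pcon i j\<close> is
  \<open>\<omega>\<^sup>i\<^sub>j\<close>, \<open>psff a b\<close> is \<open>A\<^sub>a\<^sub>b\<close>, \<open>proot\<close> is the chosen square root of
  \<open>h\<^sub>2\<close>, and \<open>ph j\<close> is \<open>h\<^sub>j\<close> for \<open>j \<ge> 2\<close>.
\<close>

record cmc_patch =
  pdom :: "(real^3) set"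
  pcof :: "nat \<Rightarrow> one_form"
  pcon :: "nat \<Rightarrow> nat \<Rightarrow> one_form"
  psff :: "nat \<Rightarrow> nat \<Rightarrow> real^3 \<Rightarrow> real"
  proot :: "real^3 \<Rightarrow> complex"
  ph :: "nat \<Rightarrow> real^3 \<Rightarrow> complex"

definition xi :: "cmc_patch \<Rightarrow> real^3 \<Rightarrow> real^3 \<Rightarrow> complex" where
  "xi P x v = Complex (pcof P 1 x v) (pcof P 2 x v)"

definition rho :: "cmc_patch \<Rightarrow> one_form" where
  "rho P = pcon P 1 2"

text \<open>
  With \<open>h\<^sub>2 = (A\<^sub>1\<^sub>1 - A\<^sub>2\<^sub>2)/2 - \<i> A\<^sub>1\<^sub>2\<close> one has
  \<open>\<omega>\<^sup>3\<^sub>1 - \<i> \<omega>\<^sup>3\<^sub>2 = h\<^sub>2 \<xi> + \<delta> \<xi>\<^sup>*\<close> with \<open>\<xi>\<^sup>*\<close> the conjugate of \<open>\<xi>\<close>, and the Cartan structure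
  equations below become \<open>d\<xi> = \<i> \<rho> \<and> \<xi>\<close>,
  \<open>d\<rho> = (\<epsilon> + \<delta>\<^sup>2 - |h\<^sub>2|\<^sup>2) (\<i>/2) \<xi> \<and> \<xi>\<^sup>*\<close> (Gauss) and
  \<open>(dh\<^sub>2 + 2\<i> h\<^sub>2 \<rho>) \<and> \<xi> = 0\<close> (Codazzi).
\<close>

definition is_cmc_patch :: "real \<Rightarrow> real \<Rightarrow> cmc_patch \<Rightarrow> bool" where
  "is_cmc_patch \<epsilon> \<delta> P \<longleftrightarrow>
    open (pdom P) \<and>
    (\<forall>i\<in>{1..3}. smooth_one_form (pdom P) (pcof P i)) \<and>
    (\<forall>i\<in>{1..3}. \<forall>j\<in>{1..3}. smooth_one_form (pdom P) (pcon P i j)) \<and>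
    (\<forall>a\<in>{1,2}. \<forall>b\<in>{1,2}. smooth_on (pdom P) (psff P a b)) \<and>
    smooth_on (pdom P) (proot P) \<and>
    (\<forall>j\<ge>2. smooth_on (pdom P) (ph P j)) \<and>
    \<comment> \<open>\<open>\<omega>\<^sup>1\<close>, \<open>\<omega>\<^sup>2\<close>, \<open>\<omega>\<^sup>1\<^sub>2\<close> form a coframe\<close>
    (\<forall>x\<in>pdom P. \<forall>v. pcof P 1 x v = 0 \<and> pcof P 2 x v = 0 \<and> pcon P 1 2 x v = 0 \<longrightarrow> v = 0) \<and>
    \<comment> \<open>structure equations of a space form of curvature \<open>\<epsilon>\<close>\<close>
    (\<forall>x\<in>pdom P. \<forall>i\<in>{1..3}. \<forall>j\<in>{1..3}. \<forall>v. pcon P i j x v = - pcon P j i x v) \<and>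
    (\<forall>x\<in>pdom P. \<forall>i\<in>{1..3}. \<forall>u v.
       ext_deriv (pcof P i) x u v = - (\<Sum>j=1..3. wedge (pcon P i j) (pcof P j) x u v)) \<and>
    (\<forall>x\<in>pdom P. \<forall>i\<in>{1..3}. \<forall>j\<in>{1..3}. \<forall>u v.
       ext_deriv (pcon P i j) x u v =
         - (\<Sum>k=1..3. wedge (pcon P i k) (pcon P k j) x u v)
         + \<epsilon> * wedge (pcof P i) (pcof P j) x u v) \<and>
    \<comment> \<open>adapted frames of a surface of constant mean curvature \<open>\<delta>\<close>\<close>
    (\<forall>x\<in>pdom P. \<forall>v. pcof P 3 x v = 0) \<and>
    (\<forall>x\<in>pdom P. \<forall>a\<in>{1,2}. \<forall>v.
       pcon P 3 a x v = psff P a 1 x * pcof P 1 x v + psff P a 2 x * pcof P 2 x v) \<and>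
    (\<forall>x\<in>pdom P. psff P 1 2 x = psff P 2 1 x) \<and>
    (\<forall>x\<in>pdom P. (psff P 1 1 x + psff P 2 2 x) / 2 = \<delta>) \<and>
    \<comment> \<open>Hopf differential \<open>h\<^sub>2 \<xi>\<^sup>2\<close>, without zeros, and its square root\<close>
    (\<forall>x\<in>pdom P. ph P 2 x = Complex ((psff P 1 1 x - psff P 2 2 x) / 2) (- psff P 1 2 x)) \<and>
    (\<forall>x\<in>pdom P. ph P 2 x \<noteq> 0 \<and> (proot P x)\<^sup>2 = ph P 2 x) \<and>
    \<comment> \<open>the successive covariant derivatives \<open>h\<^sub>j\<close>\<close>
    (\<exists>T :: nat \<Rightarrow> real^3 \<Rightarrow> complex.
       (\<forall>x\<in>pdom P. T 2 x = 0) \<and>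
       (\<forall>j\<ge>2. \<forall>x\<in>pdom P. \<forall>v.
          frechet_derivative (ph P j) (at x) v + \<i> * of_nat j * ph P j x * of_real (rho P x v)
          = ph P (Suc j) x * xi P x v + T j x * cnj (xi P x v)))"

type_synonym 'm chart = "'m set \<times> ('m \<Rightarrow> real^3)"

definition chart_inv :: "'m chart \<Rightarrow> real^3 \<Rightarrow> 'm" where
  "chart_inv \<kappa> = inv_into (fst \<kappa>) (snd \<kappa>)"

definition transition :: "'m chart \<Rightarrow> 'm chart \<Rightarrow> real^3 \<Rightarrow> real^3" where
  "transition \<kappa> \<kappa>' = snd \<kappa>' \<circ> chart_inv \<kappa>"

definition overlap :: "'m chart \<Rightarrow> 'm chart \<Rightarrow> (real^3) set" where
  "overlap \<kappa> \<kappa>' = snd \<kappa> ` (fst \<kappa> \<inter> fst \<kappa>')"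

definition smooth_atlas :: "'m::topological_space chart set \<Rightarrow> bool" where
  "smooth_atlas C \<longleftrightarrow>
     (\<forall>\<kappa>\<in>C. open (fst \<kappa>) \<and> open (snd \<kappa> ` fst \<kappa>) \<and>
        homeomorphism (fst \<kappa>) (snd \<kappa> ` fst \<kappa>) (snd \<kappa>) (chart_inv \<kappa>)) \<and>
     (\<Union>\<kappa>\<in>C. fst \<kappa>) = UNIV \<and>
     (\<forall>\<kappa>\<in>C. \<forall>\<kappa>'\<in>C. smooth_on (overlap \<kappa> \<kappa>') (transition \<kappa> \<kappa>'))"

text \<open>A 1-form on a manifold is given by its local expressions in the charts of the atlas.\<close>

definition global_one_form :: "'m chart set \<Rightarrow> ('m chart \<Rightarrow> one_form) \<Rightarrow> bool" where
  "global_one_form C \<alpha> \<longleftrightarrow>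
     (\<forall>\<kappa>\<in>C. \<forall>\<kappa>'\<in>C. \<forall>x\<in>overlap \<kappa> \<kappa>'. \<forall>v.
        \<alpha> \<kappa> x v = \<alpha> \<kappa>' (transition \<kappa> \<kappa>' x) (frechet_derivative (transition \<kappa> \<kappa>') (at x) v))"

record 'm cmc_surface =
  charts :: "'m chart set"
  cof :: "nat \<Rightarrow> 'm chart \<Rightarrow> one_form"
  con :: "nat \<Rightarrow> nat \<Rightarrow> 'm chart \<Rightarrow> one_form"
  sff :: "nat \<Rightarrow> nat \<Rightarrow> 'm \<Rightarrow> real"
  hroot :: "'m \<Rightarrow> complex"
  hcoeff :: "nat \<Rightarrow> 'm \<Rightarrow> complex"

definition patch_of :: "'m cmc_surface \<Rightarrow> 'm chart \<Rightarrow> cmc_patch" where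
  "patch_of S \<kappa> =
     \<lparr> pdom = snd \<kappa> ` fst \<kappa>,
       pcof = (\<lambda>i. cof S i \<kappa>),
       pcon = (\<lambda>i j. con S i j \<kappa>),
       psff = (\<lambda>a b. sff S a b \<circ> chart_inv \<kappa>),
       proot = hroot S \<circ> chart_inv \<kappa>,
       ph = (\<lambda>j. hcoeff S j \<circ> chart_inv \<kappa>) \<rparr>"

definition is_cmc_surface ::
    "real \<Rightarrow> real \<Rightarrow> 'm::{t2_space, second_countable_topology} cmc_surface \<Rightarrow> bool" where
  "is_cmc_surface \<epsilon> \<delta> S \<longleftrightarrow>
     smooth_atlas (charts S) \<and>
     (\<forall>i\<in>{1..3}. global_one_form (charts S) (cof S i)) \<and>
     (\<forall>i\<in>{1..3}. \<forall>j\<in>{1..3}. global_one_form (charts S) (con S i j)) \<and>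
     (\<forall>\<kappa>\<in>charts S. is_cmc_patch \<epsilon> \<delta> (patch_of S \<kappa>))"

subsection \<open>The jet space\<close>

text \<open>
  A jet \<open>p = (s, h)\<close> has the coordinates \<open>s\<close>, which stands for \<open>h\<^sub>2\<close> to the power
  \<open>1/2\<close>, and \<open>h j\<close> for \<open>j \<ge> 3\<close>; the values \<open>h 0, h 1, h 2\<close> play no role. The
  conjugate coordinates are left out because the canonical formal Killing field does not involve them.
\<close>

type_synonym jet = "complex \<times> (nat \<Rightarrow> complex)"

definition jet_space :: "jet set" where
  "jet_space = {p. fst p \<noteq> 0}"

definition patch_jet :: "cmc_patch \<Rightarrow> real^3 \<Rightarrow> jet" where
  "patch_jet P x = (proot P x, \<lambda>j. ph P j x)"

definition surface_jet :: "'m cmc_surface \<Rightarrow> 'm \<Rightarrow> jet" where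
  "surface_jet S q = (hroot S q, \<lambda>j. hcoeff S j q)"

definition zcoord :: "nat \<Rightarrow> jet \<Rightarrow> complex" where
  "zcoord j p = snd p j / fst p ^ j"

text \<open>The polynomials in \<open>z\<^sub>3, z\<^sub>4, \<dots>\<close>, as functions on the jet space.\<close>

inductive_set z_polynomials :: "(jet \<Rightarrow> complex) set" where
  const: "(\<lambda>p. k) \<in> z_polynomials"
| var: "j \<ge> 3 \<Longrightarrow> zcoord j \<in> z_polynomials"
| add: "f \<in> z_polynomials \<Longrightarrow> g \<in> z_polynomials \<Longrightarrow> (\<lambda>p. f p + g p) \<in> z_polynomials"
| mult: "f \<in> z_polynomials \<Longrightarrow> g \<in> z_polynomials \<Longrightarrow> (\<lambda>p. f p * g p) \<in> z_polynomials"

text \<open>The polynomials in \<open>s\<close>, \<open>1/s\<close> and \<open>h\<^sub>3, h\<^sub>4, \<dots>\<close>, as functions on the jet space.\<close>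

inductive_set jet_ring :: "(jet \<Rightarrow> complex) set" where
  const: "(\<lambda>p. k) \<in> jet_ring"
| root: "fst \<in> jet_ring"
| inverse_root: "(\<lambda>p. inverse (fst p)) \<in> jet_ring"
| var: "j \<ge> 3 \<Longrightarrow> (\<lambda>p. snd p j) \<in> jet_ring"
| add: "f \<in> jet_ring \<Longrightarrow> g \<in> jet_ring \<Longrightarrow> (\<lambda>p. f p + g p) \<in> jet_ring"
| mult: "f \<in> jet_ring \<Longrightarrow> g \<in> jet_ring \<Longrightarrow> (\<lambda>p. f p * g p) \<in> jet_ring"

subsection \<open>The canonical formal Killing field\<close>

text \<open>Formal series in \<open>\<lambda>\<close> are elements of type \<^typ>\<open>complex fls\<close>, with \<open>\<lambda>\<close> being
  \<^const>\<open>fls_X\<close>.\<close>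

type_synonym loop_matrix = "complex fls^2^2"

definition mat22 :: "complex fls \<Rightarrow> complex fls \<Rightarrow> complex fls \<Rightarrow> complex fls \<Rightarrow> loop_matrix" where
  "mat22 x11 x12 x21 x22 = vector [vector [x11, x12], vector [x21, x22]]"

definition commutator :: "loop_matrix \<Rightarrow> loop_matrix \<Rightarrow> loop_matrix" where
  "commutator X Y = X ** Y - Y ** X"

text \<open>The matrix \<open>Y\<close> formed from coefficients \<open>a\<close>, \<open>b\<close>, \<open>c\<close>; the first argument of these is the
  superscript. Only odd superscripts of \<open>a\<close> and even positive superscripts of \<open>b\<close> and \<open>c\<close> are used.\<close>

definition killing_matrix ::
    "(nat \<Rightarrow> jet \<Rightarrow> complex) \<Rightarrow> (nat \<Rightarrow> jet \<Rightarrow> complex) \<Rightarrow> (nat \<Rightarrow> jet \<Rightarrow> complex) \<Rightarrow> jet \<Rightarrow> loop_matrix" where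
  "killing_matrix a b c p =
     (let A = fps_to_fls (Abs_fps (\<lambda>k. if even k then a (k + 1) p else 0));
          B = fps_to_fls (Abs_fps (\<lambda>k. if odd k then b (k + 1) p else 0));
          C = fps_to_fls (Abs_fps (\<lambda>k. if odd k then c (k + 1) p else 0))
      in mat22 (- fls_const \<i> * A) (2 * C) (2 * B) (fls_const \<i> * A))"

text \<open>\<open>coeffwise L Y\<close> applies a functional \<open>L\<close> (a tangent vector acting on functions) to the
  coefficients of a family \<open>Y\<close> of matrices of power series, i.e. without negative powers of \<open>\<lambda>\<close>.\<close>

definition coeffwise :: "(('p \<Rightarrow> complex) \<Rightarrow> complex) \<Rightarrow> ('p \<Rightarrow> loop_matrix) \<Rightarrow> loop_matrix" where
  "coeffwise L Y =
     (\<chi> i j. fps_to_fls (Abs_fps (\<lambda>n. L (\<lambda>p. fls_nth (Y p $ i $ j) (int n)))))"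

text \<open>The value of \<open>\<phi>\<^sub>\<lambda>\<close> at the point \<open>x\<close> on the tangent vector \<open>v\<close>.\<close>

definition phi :: "real \<Rightarrow> cmc_patch \<Rightarrow> real^3 \<Rightarrow> real^3 \<Rightarrow> loop_matrix" where
  "phi \<gamma> P x v =
     (let \<xi> = xi P x v; r = complex_of_real (rho P x v); h2 = ph P 2 x; g = complex_of_real \<gamma>
      in mat22
           (fls_const (\<i> / 2 * r))
           (- fls_X * fls_const (g / 2 * cnj \<xi>) - fls_X_inv * fls_const (h2 / 2 * \<xi>))
           (fls_X * fls_const (cnj h2 / 2 * cnj \<xi>) + fls_X_inv * fls_const (g / 2 * \<xi>))
           (- fls_const (\<i> / 2 * r)))"

text \<open>The equation \<open>dY + [\<phi>\<^sub>\<lambda>, Y] = 0\<close> between expressions on the infinite jet space means that it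
  holds along every CMC surface, for all \<open>\<epsilon>\<close>, \<open>\<delta>\<close> with \<open>\<gamma>\<^sup>2 = \<epsilon> + \<delta>\<^sup>2\<close>.\<close>

definition canonical_formal_killing_field ::
    "real \<Rightarrow> (nat \<Rightarrow> jet \<Rightarrow> complex) \<Rightarrow> (nat \<Rightarrow> jet \<Rightarrow> complex) \<Rightarrow> (nat \<Rightarrow> jet \<Rightarrow> complex) \<Rightarrow> bool" where
  "canonical_formal_killing_field \<gamma> a b c \<longleftrightarrow>
     (\<forall>n. a (2 * n + 1) \<in> z_polynomials) \<and>
     (\<forall>n. \<exists>f\<in>z_polynomials. b (2 * n + 2) = (\<lambda>p. f p / fst p)) \<and>
     (\<forall>n. \<exists>f\<in>z_polynomials. c (2 * n + 2) = (\<lambda>p. f p * fst p)) \<and>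
     (\<forall>p\<in>jet_space. a 1 p = 0) \<and>
     (\<forall>p\<in>jet_space. b 2 p = - \<i> * of_real \<gamma> / fst p) \<and>
     (\<forall>p\<in>jet_space. c 2 p = \<i> * fst p) \<and>
     (\<forall>p\<in>jet_space. det (killing_matrix a b c p) = fls_const (- 4 * of_real \<gamma>) * fls_X ^ 2) \<and>
     (\<forall>\<epsilon> \<delta> P. \<gamma>\<^sup>2 = \<epsilon> + \<delta>\<^sup>2 \<longrightarrow> is_cmc_patch \<epsilon> \<delta> P \<longrightarrow>
        (\<forall>x\<in>pdom P. \<forall>v.
           coeffwise (\<lambda>f. frechet_derivative f (at x) v) (\<lambda>x. killing_matrix a b c (patch_jet P x))
           + commutator (phi \<gamma> P x v) (killing_matrix a b c (patch_jet P x)) = 0))"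

subsection \<open>The CMC hierarchy\<close>

definition fls_negative_part :: "complex fls \<Rightarrow> complex fls" where
  "fls_negative_part f = f - fps_to_fls (fls_regpart f)"

definition U_part :: "(jet \<Rightarrow> loop_matrix) \<Rightarrow> nat \<Rightarrow> jet \<Rightarrow> loop_matrix" where
  "U_part Y m p =
     (\<chi> i j. fls_negative_part
        (fls_const (1 / (2 * \<i>)) * fls_X_intpow (- 2 * int m - 2) * (Y p $ i $ j)))"

text \<open>A vector field on the jet space is identified with its action on functions: a derivation of
  \<^const>\<open>jet_ring\<close>. Its values on other functions are irrelevant.\<close>

type_synonym jet_operator = "(jet \<Rightarrow> complex) \<Rightarrow> jet \<Rightarrow> complex"

definition jet_vector_field :: "jet_operator \<Rightarrow> bool" where
  "jet_vector_field D \<longleftrightarrow>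
     (\<forall>f\<in>jet_ring. D f \<in> jet_ring) \<and>
     (\<forall>k. \<forall>p\<in>jet_space. D (\<lambda>p. k) p = 0) \<and>
     (\<forall>f\<in>jet_ring. \<forall>g\<in>jet_ring. \<forall>p\<in>jet_space. D (\<lambda>p. f p + g p) p = D f p + D g p) \<and>
     (\<forall>f\<in>jet_ring. \<forall>g\<in>jet_ring. \<forall>p\<in>jet_space. D (\<lambda>p. f p * g p) p = D f p * g p + f p * D g p)"

text \<open>The defining action of the symmetries \<open>\<partial>\<^bsub>t\<^sub>m\<^esub>\<close>. It determines them on
  \<^const>\<open>jet_ring\<close>, since the coefficients of \<open>Y\<close> generate \<open>s\<close>, \<open>1/s\<close> and all \<open>h\<^sub>j\<close>.\<close>

definition cmc_hierarchy ::
    "(nat \<Rightarrow> jet \<Rightarrow> complex) \<Rightarrow> (nat \<Rightarrow> jet \<Rightarrow> complex) \<Rightarrow> (nat \<Rightarrow> jet \<Rightarrow> complex) \<Rightarrow>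
     (nat \<Rightarrow> jet_operator) \<Rightarrow> bool" where
  "cmc_hierarchy a b c dt \<longleftrightarrow>
     (\<forall>m. jet_vector_field (dt m) \<and>
       (\<forall>p\<in>jet_space.
          coeffwise (\<lambda>f. dt m f p) (killing_matrix a b c)
            = - commutator (U_part (killing_matrix a b c) m p) (killing_matrix a b c p)) \<and>
       (\<forall>p\<in>jet_space. dt m (\<lambda>p. (fst p)\<^sup>2) p = - 2 * (fst p)\<^sup>2 * a (2 * m + 3) p))"

definition symmetry :: "(nat \<Rightarrow> jet_operator) \<Rightarrow> nat \<Rightarrow> (nat \<Rightarrow> complex) \<Rightarrow> jet_operator" where
  "symmetry dt N k = (\<lambda>f p. \<Sum>i\<le>N. k i * dt i f p)"

definition linear_finite_type :: "(nat \<Rightarrow> jet \<Rightarrow> complex) \<Rightarrow> 'm cmc_surface \<Rightarrow> bool" where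
  "linear_finite_type a S \<longleftrightarrow>
     (\<exists>N k. (\<exists>i\<le>N. k i \<noteq> 0) \<and> (\<forall>q. (\<Sum>i\<le>N. k i * a (2 * i + 3) (surface_jet S q)) = 0))"

end

theory Submission
  imports Defs
begin

text \<open>
  Let \<open>K\<close> be the canonical formal Killing field and
  \<open>s = \<Sum>i\<le>N. k\<^sub>i / (2\<i>) \<lambda>\<^sup>-\<^sup>2\<^sup>i\<^sup>-\<^sup>2\<close>. The symmetry with coefficients \<open>k\<^sub>i\<close> acts on
  \<open>K\<close> by \<open>- [U, K]\<close>, where \<open>U\<close> is the part of \<open>s K\<close> of negative degree in \<open>\<lambda>\<close>. Let \<open>Q\<close> be
  the complementary part, a matrix of power series. As \<open>s K = Q + U\<close> commutes with \<open>K\<close>, the symmetry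
  acts by \<open>X = [Q, K]\<close>, and the coefficient \<open>Q\<^sub>0\<close> is \<open>\<Sum>i\<le>N. k\<^sub>i a\<^bsup>2i+3\<^esup>\<close> times a fixed
  diagonal matrix. Linear finite type with constants \<open>k\<^sub>i\<close> thus means \<open>Q\<^sub>0 = 0\<close> along the surface,
  and this is equivalent to \<open>X = 0\<close> with the same constants.

  If \<open>X = 0\<close>, then its coefficient \<open>[Q\<^sub>0, K\<^sub>1]\<close> of \<open>\<lambda>\<close> vanishes. The matrix \<open>K\<^sub>1\<close> is off-diagonal
  and nonzero, so \<open>Q\<^sub>0 = 0\<close>; this holds point by point (\<open>stationary_imp_jacobi_zero\<close>).

  Conversely let \<open>Q\<^sub>0 = 0\<close> along the surface. Split \<open>\<phi>\<^sub>\<lambda>\<close> by degree as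
  \<open>\<lambda>\<^sup>-\<^sup>1 \<xi> \<phi>\<^sub>- + \<phi>\<^sub>0 + \<lambda> \<xi>\<^sup>* \<phi>\<^sub>+\<close>. The matrix \<open>s K\<close> satisfies the Killing equation, and truncating it
  spoils that equation only by \<open>[\<phi>\<^sub>-, Q\<^sub>0]\<close> in degree \<open>- 1\<close> and \<open>[\<phi>\<^sub>+, U\<^sub>-\<^sub>1]\<close> in degree \<open>0\<close>.
  The first is zero by hypothesis, and so is the second: it is the \<open>\<xi>\<^sup>*\<close>-component of the degree
  \<open>0\<close> equation, all of whose other components are along \<open>\<xi>\<close> or vanish with \<open>Q\<^sub>0\<close>. Hence
  \<open>dQ + [\<phi>\<^sub>\<lambda>, Q] = 0\<close> (\<open>parallel_symmetry_matrix\<close>), and by the Jacobi identity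
  \<open>dX + [\<phi>\<^sub>\<lambda>, X] = 0\<close> (\<open>parallel_commutator\<close>). The lowest nonzero coefficient of such an \<open>X\<close> commutes
  with \<open>\<phi>\<^sub>-\<close>, hence is a multiple of \<open>K\<^sub>1\<close>, which is proportional to \<open>\<phi>\<^sub>-\<close>. But \<open>tr (X K) = 0\<close>
  and \<open>tr (K\<^sub>1\<^sup>2) \<noteq> 0\<close> because \<open>\<gamma> \<noteq> 0\<close>, so there is no such coefficient and \<open>X = 0\<close>
  (\<open>parallel_zero\<close>).
\<close>

(* With the power series reading of $ removed, nested component selections parse unambiguously. *)
no_notation fps_nth (infixl "$" 75)
notation fls_nth (infixl "$$" 75)

section \<open>Loop matrices and their coefficients\<close>

definition mat_nth :: "loop_matrix \<Rightarrow> int \<Rightarrow> complex^2^2" where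
  "mat_nth Y n = (\<chi> i j. fls_nth (Y $ i $ j) n)"

definition regular :: "loop_matrix \<Rightarrow> bool" where
  "regular Y \<longleftrightarrow> (\<forall>n<0. mat_nth Y n = 0)"

definition regular_part :: "loop_matrix \<Rightarrow> loop_matrix" where
  "regular_part Y = (\<chi> i j. fps_to_fls (fls_regpart (Y $ i $ j)))"

definition scale_mat :: "'a::times \<Rightarrow> 'a^2^2 \<Rightarrow> 'a^2^2" where
  "scale_mat f Y = (\<chi> i j. f * Y $ i $ j)"

definition bracket :: "complex^2^2 \<Rightarrow> complex^2^2 \<Rightarrow> complex^2^2" where
  "bracket A B = A ** B - B ** A"

lemmas mat2_simps = vec_eq_iff forall_2 matrix_matrix_mult_def sum_2

lemma bracket_0 [simp]: "bracket A 0 = 0" and scale_mat_0 [simp]: "scale_mat (u :: complex) 0 = 0"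
  by (simp_all add: bracket_def scale_mat_def mat2_simps)

lemma mat_nth_eqI: "(\<And>n. mat_nth X n = mat_nth Y n) \<Longrightarrow> X = Y"
  by (simp add: mat_nth_def vec_eq_iff fls_eq_iff)

lemma mat_nth_arith [simp]:
  "mat_nth 0 n = 0"
  "mat_nth (X + Y) n = mat_nth X n + mat_nth Y n"
  "mat_nth (X - Y) n = mat_nth X n - mat_nth Y n"
  "mat_nth (- X) n = - mat_nth X n"
  by (simp_all add: mat_nth_def vec_eq_iff)

lemma regular_nth: "regular Y \<Longrightarrow> n < 0 \<Longrightarrow> Y $ i $ j $$ n = 0"
  by (simp add: regular_def mat_nth_def vec_eq_iff)

lemma mat_nth_regular_part: "mat_nth (regular_part Y) n = (if n < 0 then 0 else mat_nth Y n)"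
  by (simp add: mat_nth_def regular_part_def vec_eq_iff)

lemma regular_regular_part: "regular (regular_part Y)"
  by (simp add: regular_def mat_nth_regular_part)

lemma fls_mult_nth_leading:
  fixes f g :: "complex fls"
  assumes f: "\<And>m. m < p \<Longrightarrow> f $$ m = 0" and g: "\<And>m. m < q \<Longrightarrow> g $$ m = 0"
  shows "(f * g) $$ (p + q) = f $$ p * g $$ q"
proof -
  have term0: "f $$ i * g $$ (p + q - i) = 0" if "i \<noteq> p" for i
    using f[of i] g[of "p + q - i"] that by (cases "i < p") auto
  let ?I = "{fls_subdegree f..p + q - fls_subdegree g}"
  have "(f * g) $$ (p + q) = (\<Sum>i\<in>?I. f $$ i * g $$ (p + q - i))"
    by (rule fls_times_nth)
  also have "\<dots> = (\<Sum>i\<in>?I. if i = p then f $$ p * g $$ q else 0)"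
    by (rule sum.cong) (use term0 in auto)
  also have "\<dots> = f $$ p * g $$ q"
    by (auto simp: not_le)
  finally show ?thesis .
qed

text \<open>All the low-order information about products is read off from their lowest possible
  coefficient, so that no convolution of matrices is needed.\<close>

lemma mat_nth_mult_leading:
  assumes "\<And>m. m < p \<Longrightarrow> mat_nth F m = 0" and "\<And>m. m < q \<Longrightarrow> mat_nth G m = 0"
  shows "mat_nth (F ** G) (p + q) = mat_nth F p ** mat_nth G q"
proof -
  have "(F $ i $ k * G $ k $ j) $$ (p + q) = F $ i $ k $$ p * G $ k $ j $$ q" for i j k
    using assms by (intro fls_mult_nth_leading) (auto simp: mat_nth_def vec_eq_iff)
  then show ?thesis
    by (simp add: mat_nth_def mat2_simps)
qed

lemma mat_nth_commutator_leading:
  assumes "\<And>m. m < p \<Longrightarrow> mat_nth F m = 0" and "\<And>m. m < q \<Longrightarrow> mat_nth G m = 0"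
  shows "mat_nth (commutator F G) (p + q) = bracket (mat_nth F p) (mat_nth G q)"
proof -
  have "mat_nth (F ** G) (p + q) = mat_nth F p ** mat_nth G q"
    and "mat_nth (G ** F) (q + p) = mat_nth G q ** mat_nth F p"
    using assms by (intro mat_nth_mult_leading; blast)+
  then show ?thesis
    by (simp add: commutator_def bracket_def add.commute)
qed

lemma regular_commutator:
  assumes "regular F" and "regular G"
  shows "regular (commutator F G)"
  unfolding regular_def
proof (intro allI impI)
  fix n :: int assume n: "n < 0"
  have "mat_nth (commutator F G) (n + 0) = bracket (mat_nth F n) (mat_nth G 0)"
    using assms n by (intro mat_nth_commutator_leading) (auto simp: regular_def)
  then show "mat_nth (commutator F G) n = 0"
    using assms n by (simp add: regular_def bracket_def)
qed

lemma matrix_mult_diff_distrib: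
  fixes A :: "'a::comm_ring_1^2^2"
  shows "A ** (B - C) = A ** B - A ** C" and "(B - C) ** A = B ** A - C ** A"
  by (simp_all add: mat2_simps algebra_simps)

lemma matrix_mult_minus:
  fixes A :: "'a::comm_ring_1^2^2"
  shows "A ** (- B) = - (A ** B)" and "(- A) ** B = - (A ** B)"
  by (simp_all add: mat2_simps)

text \<open>The Jacobi identity, in the form that makes commutation with \<open>F\<close> a derivation.\<close>

lemma commutator_jacobi:
  "commutator F (commutator X Y) = commutator (commutator F X) Y + commutator X (commutator F Y)"
  by (simp add: commutator_def matrix_mult_diff_distrib matrix_mul_assoc)

lemma commutator_minus:
  shows "commutator (- X) Y = - commutator X Y" and "commutator X (- Y) = - commutator X Y"
  by (simp_all add: commutator_def matrix_mult_minus)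

lemma commutator_scale_right: "commutator F (scale_mat f Y) = scale_mat f (commutator F Y)"
  by (simp add: commutator_def scale_mat_def mat2_simps algebra_simps)

lemma commutator_scale_self: "commutator (scale_mat f Y) Y = 0"
  by (simp add: commutator_def scale_mat_def mat2_simps algebra_simps)

lemma commutator_diff_left: "commutator (F - G) Y = commutator F Y - commutator G Y"
  by (simp add: commutator_def mat2_simps algebra_simps)

lemma trace_diff2: "trace (A - B) = trace A - trace (B :: 'a::comm_ring_1^2^2)"
  by (simp add: trace_def sum_2)

lemma trace_commutator: "trace (commutator X Y) = 0"
  by (simp add: commutator_def trace_diff2 trace_mul_sym[of X])

text \<open>This is the invariance of \<open>tr (Y\<^sup>2)\<close> under conjugation: a variation of \<open>Y\<close> by a
  commutator is orthogonal to \<open>Y\<close> for the trace form.\<close>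

lemma trace_commutator_mult: "trace (commutator X Y ** Y) = 0"
proof -
  have "commutator X Y ** Y = commutator (X ** Y) Y"
    by (simp add: commutator_def matrix_mult_diff_distrib matrix_mul_assoc)
  then show ?thesis
    by (simp add: trace_commutator)
qed

section \<open>Differentiation of loop matrices\<close>

abbreviation deriv_mat :: "real^3 \<Rightarrow> real^3 \<Rightarrow> (real^3 \<Rightarrow> loop_matrix) \<Rightarrow> loop_matrix" where
  "deriv_mat x v F \<equiv> coeffwise (\<lambda>f. frechet_derivative f (at x) v) F"

definition deriv_fls :: "real^3 \<Rightarrow> real^3 \<Rightarrow> (real^3 \<Rightarrow> complex fls) \<Rightarrow> complex fls" where
  "deriv_fls x v f = fps_to_fls (Abs_fps (\<lambda>n. frechet_derivative (\<lambda>y. f y $$ int n) (at x) v))"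

definition fls_differentiable :: "real^3 \<Rightarrow> (real^3 \<Rightarrow> complex fls) \<Rightarrow> bool" where
  "fls_differentiable x f \<longleftrightarrow> (\<forall>n. (\<lambda>y. f y $$ n) differentiable (at x))"

definition mat_differentiable :: "real^3 \<Rightarrow> (real^3 \<Rightarrow> loop_matrix) \<Rightarrow> bool" where
  "mat_differentiable x F \<longleftrightarrow> (\<forall>i j. fls_differentiable x (\<lambda>y. F y $ i $ j))"

lemma deriv_mat_nth: "deriv_mat x v F $ i $ j = deriv_fls x v (\<lambda>y. F y $ i $ j)"
  by (simp add: coeffwise_def deriv_fls_def)

lemma has_derivative_frechet:
  "f differentiable (at x) \<Longrightarrow> (f has_derivative frechet_derivative f (at x)) (at x)"
  by (simp add: frechet_derivative_works)

lemma frechet_derivative_zero_on_open: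
  assumes "open V" and "x \<in> V" and "\<And>y. y \<in> V \<Longrightarrow> f y = 0"
  shows "frechet_derivative f (at x) v = 0"
proof -
  have "(f has_derivative (\<lambda>_. 0)) (at x)"
    using assms by (intro has_derivative_transform_within_open[OF has_derivative_const]) auto
  then show ?thesis
    by (metis frechet_derivative_at)
qed

lemma frechet_derivative_add_diff:
  assumes "f differentiable (at x)" and "g differentiable (at x)"
  shows "frechet_derivative (\<lambda>y. f y + g y) (at x) v
      = frechet_derivative f (at x) v + frechet_derivative g (at x) v"
    and "frechet_derivative (\<lambda>y. f y - g y) (at x) v
      = frechet_derivative f (at x) v - frechet_derivative g (at x) v"
  using frechet_derivative_at[OF has_derivative_add[OF assms[THEN has_derivative_frechet]], symmetric]
    frechet_derivative_at[OF has_derivative_diff[OF assms[THEN has_derivative_frechet]], symmetric]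
  by simp_all

lemma deriv_fls_linear:
  assumes "fls_differentiable x f" and "fls_differentiable x g"
  shows "deriv_fls x v (\<lambda>y. f y + g y) = deriv_fls x v f + deriv_fls x v g"
    and "deriv_fls x v (\<lambda>y. f y - g y) = deriv_fls x v f - deriv_fls x v g"
    and "fls_differentiable x (\<lambda>y. f y + g y)"
    and "fls_differentiable x (\<lambda>y. f y - g y)"
  using assms
  by (auto simp: deriv_fls_def fls_differentiable_def fls_eq_iff frechet_derivative_add_diff)

lemma fls_times_nth_regular:
  fixes f g :: "complex fls"
  assumes "\<And>m. m < 0 \<Longrightarrow> f $$ m = 0" and "\<And>m. m < 0 \<Longrightarrow> g $$ m = 0"
  shows "(f * g) $$ n = (if n < 0 then 0 else \<Sum>i=0..nat n. f $$ int i * g $$ int (nat n - i))"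
proof -
  have "f = fps_to_fls (fls_regpart f)" and "g = fps_to_fls (fls_regpart g)"
    using assms by (auto simp: fls_eq_iff)
  then have "f * g = fps_to_fls (fls_regpart f * fls_regpart g)"
    by (metis fls_times_fps_to_fls)
  then show ?thesis
    by (simp add: fps_mult_nth)
qed

text \<open>For series without negative powers a coefficient of a product is a finite sum of products of
  coefficients, with a range independent of the point; coefficientwise differentiation therefore obeys
  the Leibniz rule.\<close>

lemma deriv_fls_mult:
  assumes df: "fls_differentiable x f" and dg: "fls_differentiable x g"
    and rf: "\<And>y m. m < 0 \<Longrightarrow> f y $$ m = 0" and rg: "\<And>y m. m < 0 \<Longrightarrow> g y $$ m = 0"
  shows "deriv_fls x v (\<lambda>y. f y * g y) = deriv_fls x v f * g x + f x * deriv_fls x v g"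
    and "fls_differentiable x (\<lambda>y. f y * g y)"
proof -
  have prod: "(f y * g y) $$ n = (if n < 0 then 0 else \<Sum>i=0..nat n. f y $$ int i * g y $$ int (nat n - i))"
    for y n
    by (rule fls_times_nth_regular) (use rf rg in auto)
  have der: "((\<lambda>y. (f y * g y) $$ n) has_derivative
      (\<lambda>w. if n < 0 then 0 else \<Sum>i=0..nat n.
         f x $$ int i * frechet_derivative (\<lambda>y. g y $$ int (nat n - i)) (at x) w
         + frechet_derivative (\<lambda>y. f y $$ int i) (at x) w * g x $$ int (nat n - i))) (at x)" for n
    using df dg unfolding prod
    by (cases "n < 0")
      (auto simp: fls_differentiable_def simp del: of_nat_diff
        intro!: has_derivative_sum has_derivative_mult has_derivative_frechet)
  show "fls_differentiable x (\<lambda>y. f y * g y)"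
    using der by (auto simp: fls_differentiable_def differentiable_def)
  show "deriv_fls x v (\<lambda>y. f y * g y) = deriv_fls x v f * g x + f x * deriv_fls x v g"
  proof (rule fls_eqI)
    fix n
    have r: "m < 0 \<Longrightarrow> deriv_fls x v h $$ m = 0" for h m
      by (simp add: deriv_fls_def)
    show "deriv_fls x v (\<lambda>y. f y * g y) $$ n = (deriv_fls x v f * g x + f x * deriv_fls x v g) $$ n"
      using frechet_derivative_at[OF der[of n], symmetric]
      using fls_times_nth_regular[of "f x" "deriv_fls x v g" n, OF rf r]
        fls_times_nth_regular[of "deriv_fls x v f" "g x" n, OF r rg]
      by (auto simp: deriv_fls_def sum.distrib simp del: of_nat_diff)
  qed
qed

lemma deriv_mat_mult:
  assumes "mat_differentiable x F" and "mat_differentiable x G"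
    and "\<And>y. regular (F y)" and "\<And>y. regular (G y)"
  shows "deriv_mat x v (\<lambda>y. F y ** G y) = deriv_mat x v F ** G x + F x ** deriv_mat x v G"
    and "mat_differentiable x (\<lambda>y. F y ** G y)"
  using assms
  by (auto simp: mat_differentiable_def mat2_simps deriv_mat_nth deriv_fls_mult deriv_fls_linear
      regular_nth)

lemma deriv_mat_commutator:
  assumes "mat_differentiable x F" and "mat_differentiable x G"
    and "\<And>y. regular (F y)" and "\<And>y. regular (G y)"
  shows "deriv_mat x v (\<lambda>y. commutator (F y) (G y))
    = commutator (deriv_mat x v F) (G x) + commutator (F x) (deriv_mat x v G)"
proof -
  have diff: "deriv_mat x v (\<lambda>y. A y - B y) = deriv_mat x v A - deriv_mat x v B"
    if "mat_differentiable x A" "mat_differentiable x B" for A B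
    using that by (simp add: vec_eq_iff deriv_mat_nth deriv_fls_linear mat_differentiable_def)
  show ?thesis
    unfolding commutator_def
    by (simp add: diff deriv_mat_mult assms)
qed

section \<open>Parallel loop matrices along a CMC surface\<close>

text \<open>The Killing equation \<open>dF + [\<phi>\<^sub>\<lambda>, F] = 0\<close>, which says that \<open>F\<close> is parallel for the
  connection \<open>d + \<phi>\<^sub>\<lambda>\<close> acting by the adjoint representation.\<close>

definition parallel :: "real \<Rightarrow> cmc_patch \<Rightarrow> (real^3 \<Rightarrow> loop_matrix) \<Rightarrow> bool" where
  "parallel \<gamma> P F \<longleftrightarrow>
     (\<forall>x\<in>pdom P. \<forall>v. deriv_mat x v F + commutator (phi \<gamma> P x v) (F x) = 0)"

text \<open>\<open>\<phi>\<^sub>\<lambda>\<close> is \<open>\<lambda>\<^sup>-\<^sup>1 \<xi> \<phi>\<^sub>- + \<phi>\<^sub>0 + \<lambda> \<xi>\<^sup>* \<phi>\<^sub>+\<close>; the 1-forms \<open>\<xi>\<close> and \<open>\<xi>\<^sup>*\<close> are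
  split off so that \<open>\<phi>\<^sub>-\<close> and \<open>\<phi>\<^sub>+\<close> do not depend on the tangent vector.\<close>

definition phi_minus :: "real \<Rightarrow> cmc_patch \<Rightarrow> real^3 \<Rightarrow> complex^2^2" where
  "phi_minus \<gamma> P x = vector [vector [0, - ph P 2 x / 2], vector [of_real \<gamma> / 2, 0]]"

definition phi_zero :: "cmc_patch \<Rightarrow> real^3 \<Rightarrow> real^3 \<Rightarrow> complex^2^2" where
  "phi_zero P x v =
     vector [vector [\<i> / 2 * of_real (rho P x v), 0], vector [0, - \<i> / 2 * of_real (rho P x v)]]"

definition phi_plus :: "real \<Rightarrow> cmc_patch \<Rightarrow> real^3 \<Rightarrow> complex^2^2" where
  "phi_plus \<gamma> P x = vector [vector [0, - of_real \<gamma> / 2], vector [cnj (ph P 2 x) / 2, 0]]"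

lemma mat_nth_commutator_phi:
  "mat_nth (commutator (phi \<gamma> P x v) W) n =
     scale_mat (xi P x v) (bracket (phi_minus \<gamma> P x) (mat_nth W (n + 1)))
     + bracket (phi_zero P x v) (mat_nth W n)
     + scale_mat (cnj (xi P x v)) (bracket (phi_plus \<gamma> P x) (mat_nth W (n - 1)))"
proof -
  have X: "(fls_X * fls_const k * f) $$ n = k * f $$ (n - 1)"
    "(fls_X_inv * fls_const k * f) $$ n = k * f $$ (n + 1)"
    "(f * (fls_X * fls_const k)) $$ n = k * f $$ (n - 1)"
    "(f * (fls_X_inv * fls_const k)) $$ n = k * f $$ (n + 1)" for f :: "complex fls" and k
  proof -
    show 1: "(fls_X * fls_const k * f) $$ n = k * f $$ (n - 1)"
      and 2: "(fls_X_inv * fls_const k * f) $$ n = k * f $$ (n + 1)"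
      unfolding mult.assoc by (simp_all add: fls_X_times_conv_shift fls_X_inv_times_conv_shift)
    show "(f * (fls_X * fls_const k)) $$ n = k * f $$ (n - 1)"
      and "(f * (fls_X_inv * fls_const k)) $$ n = k * f $$ (n + 1)"
      using 1 2 by (simp_all only: mult.commute[of f])
  qed
  show ?thesis
    by (simp add: mat2_simps commutator_def bracket_def mat22_def mat_nth_def scale_mat_def phi_def
        Let_def phi_minus_def phi_zero_def phi_plus_def ring_distribs X)
      (simp add: algebra_simps)
qed

text \<open>Differentiation is a derivation of the commutator by the Leibniz rule, and commutation with
  \<open>\<phi>\<^sub>\<lambda>\<close> is one by the Jacobi identity.\<close>

lemma parallel_commutator:
  assumes "parallel \<gamma> P F" and "parallel \<gamma> P G"
    and "\<And>x. x \<in> pdom P \<Longrightarrow> mat_differentiable x F" and "\<And>x. x \<in> pdom P \<Longrightarrow> mat_differentiable x G"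
    and "\<And>y. regular (F y)" and "\<And>y. regular (G y)"
  shows "parallel \<gamma> P (\<lambda>x. commutator (F x) (G x))"
  unfolding parallel_def
proof (intro ballI allI)
  fix x v assume x: "x \<in> pdom P"
  let ?p = "phi \<gamma> P x v"
  have "deriv_mat x v F = - commutator ?p (F x)" and "deriv_mat x v G = - commutator ?p (G x)"
    using assms(1,2) x by (auto simp: parallel_def eq_neg_iff_add_eq_0)
  then have "deriv_mat x v (\<lambda>x. commutator (F x) (G x))
      = commutator (- commutator ?p (F x)) (G x) + commutator (F x) (- commutator ?p (G x))"
    using assms x by (simp add: deriv_mat_commutator)
  also have "\<dots> = - commutator ?p (commutator (F x) (G x))"
    by (simp add: commutator_jacobi[of ?p] commutator_minus)
  finally show "deriv_mat x v (\<lambda>x. commutator (F x) (G x)) + commutator ?p (commutator (F x) (G x)) = 0"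
    by simp
qed

lemma smooth_on_differentiable: "smooth_on V f \<Longrightarrow> x \<in> V \<Longrightarrow> f differentiable (at x)"
  unfolding smooth_on_def by (metis diff_upto.simps(2))

lemma is_cmc_patchD:
  assumes "is_cmc_patch \<epsilon> \<delta> P"
  shows "open (pdom P)"
    and "\<forall>i\<in>{1..3}. smooth_one_form (pdom P) (pcof P i)"
    and "\<forall>i\<in>{1..3}. \<forall>j\<in>{1..3}. smooth_one_form (pdom P) (pcon P i j)"
    and "smooth_on (pdom P) (proot P)"
    and "\<forall>j\<ge>2. smooth_on (pdom P) (ph P j)"
    and "\<forall>x\<in>pdom P. \<forall>v. pcof P 1 x v = 0 \<and> pcof P 2 x v = 0 \<and> pcon P 1 2 x v = 0 \<longrightarrow> v = 0"
    and "\<forall>x\<in>pdom P. ph P 2 x \<noteq> 0 \<and> (proot P x)\<^sup>2 = ph P 2 x"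
  using assms unfolding is_cmc_patch_def by - (elim conjE, assumption)+

text \<open>The coframe gives an injective, hence surjective, linear map to \<open>\<real>\<^sup>3\<close>. Evaluating on vectors
  with prescribed \<open>\<xi>\<close> is what separates the \<open>\<xi>\<close>- and \<open>\<xi>\<^sup>*\<close>-components of an equation of 1-forms.\<close>

lemma xi_surj:
  assumes P: "is_cmc_patch \<epsilon> \<delta> P" and x: "x \<in> pdom P"
  obtains v where "xi P x v = z"
proof -
  have lin: "linear (pcof P 1 x)" "linear (pcof P 2 x)" "linear (pcon P 1 2 x)"
    using is_cmc_patchD(2,3)[OF P] x by (auto simp: smooth_one_form_def)
  define f :: "real^3 \<Rightarrow> real^3" where
    "f v = vector [pcof P 1 x v, pcof P 2 x v, pcon P 1 2 x v]" for v
  have f: "linear f"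
    by (rule linearI)
      (simp_all only: f_def vec_eq_iff forall_3 vector_3 vector_add_component vector_scaleR_component
        real_scaleR_def lin[THEN linear_add] lin[THEN linear_cmul] simp_thms)
  have "\<forall>v. f v = 0 \<longrightarrow> v = 0"
    using is_cmc_patchD(6)[OF P] x by (metis f_def vector_3 zero_index)
  then have "surj f"
    by (intro linear_injective_imp_surjective[OF f]) (simp_all add: linear_injective_0[OF f])
  then obtain v where "f v = vector [Re z, Im z, 0]"
    by (metis surjD)
  then have "xi P x v = z"
    unfolding xi_def f_def by (metis complex_surj vector_3(1,2))
  then show thesis ..
qed

text \<open>By induction on the order of vanishing. If all coefficients of \<open>X\<close> below degree \<open>n\<close> vanish
  on the patch, then so do their derivatives, and degree \<open>n - 1\<close> of the Killing equation says that
  the coefficient of degree \<open>n\<close> commutes with \<open>\<phi>\<^sub>-\<close>. It is traceless and orthogonal to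
  \<open>K\<^sub>1\<close>, which is a multiple of \<open>\<phi>\<^sub>-\<close> of nonzero square, and this forces it to be zero.\<close>

lemma parallel_zero:
  assumes P: "is_cmc_patch \<epsilon> \<delta> P" and \<gamma>: "\<gamma> \<noteq> 0"
    and par: "parallel \<gamma> P X"
    and X: "\<And>x. regular (X x)" "\<And>x. x \<in> pdom P \<Longrightarrow> mat_nth (X x) 0 = 0"
    and tr: "\<And>x. trace (X x) = 0" "\<And>x. trace (X x ** K x) = 0"
    and K: "\<And>x n. x \<in> pdom P \<Longrightarrow> n < 1 \<Longrightarrow> mat_nth (K x) n = 0"
    and K1: "\<And>x. x \<in> pdom P \<Longrightarrow> mat_nth (K x) 1 =
       vector [vector [0, 2 * \<i> * proot P x], vector [- 2 * \<i> * of_real \<gamma> / proot P x, 0]]"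
    and x: "x \<in> pdom P"
  shows "X x = 0"
proof -
  have "\<forall>x\<in>pdom P. mat_nth (X x) (int n) = 0" for n
  proof (induction n rule: less_induct)
    case (less n)
    show ?case
    proof (cases n)
      case 0
      then show ?thesis using X(2) by simp
    next
      case (Suc k)
      show ?thesis
      proof
        fix x assume x: "x \<in> pdom P"
        have "open (pdom P)" and root: "(proot P x)\<^sup>2 = ph P 2 x" "ph P 2 x \<noteq> 0"
          using is_cmc_patchD(1,7)[OF P] x by auto
        have below: "mat_nth (X y) m = 0" if "m < int n" "y \<in> pdom P" for m y
          using X(1) less.IH[of "nat m"] that
          by (cases "m < 0") (auto simp: regular_def)
        define M where "M = mat_nth (X x) (int n)"
        obtain v where v: "xi P x v = 1"
          using xi_surj[OF P x] .
        have "mat_nth (deriv_mat x v X) (int k) = 0"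
          using below[of "int k"] Suc
          by (auto simp: mat_nth_def vec_eq_iff deriv_mat_nth deriv_fls_def
              intro!: frechet_derivative_zero_on_open[OF \<open>open (pdom P)\<close> x])
        moreover have "mat_nth (deriv_mat x v X + commutator (phi \<gamma> P x v) (X x)) (int k) = 0"
          using par x by (simp add: parallel_def del: mat_nth_arith(2)) 
        ultimately have br: "bracket (phi_minus \<gamma> P x) (mat_nth (X x) (int n)) = 0"
          using below[of "int k"] below[of "int k - 1"] x Suc
          by (simp add: mat_nth_commutator_phi v bracket_def scale_mat_def add.commute vec_eq_iff)
        have "mat_nth (X x ** K x) (int n + 1) = mat_nth (X x) (int n) ** mat_nth (K x) 1"
          using below x K by (intro mat_nth_mult_leading) auto
        moreover have "trace (mat_nth (X x ** K x) (int n + 1)) = trace (X x ** K x) $$ (int n + 1)"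
          by (simp add: trace_def mat_nth_def sum_2)
        ultimately have "trace (mat_nth (X x) (int n) ** mat_nth (K x) 1) = 0"
          by (simp add: tr)
        moreover have "trace (mat_nth (X x) (int n)) = trace (X x) $$ int n"
          by (simp add: trace_def mat_nth_def sum_2)
        then have "trace (mat_nth (X x) (int n)) = 0"
          by (simp add: tr)
        \<comment> \<open>Being traceless and commuting with \<open>\<phi>\<^sub>-\<close> leaves \<open>M\<close> off-diagonal with
          \<open>h\<^sub>2 M\<^sub>2\<^sub>1 = - \<gamma> M\<^sub>1\<^sub>2\<close>; orthogonality to \<open>K\<^sub>1\<close> gives the same equation with the
          opposite sign.\<close>
        ultimately have "M $ 1 $ 1 + M $ 2 $ 2 = 0"
          and tr1: "M $ 1 $ 2 * (2 * \<i> * of_real \<gamma> / proot P x) = M $ 2 $ 1 * (2 * \<i> * proot P x)"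
          by (simp_all add: M_def[symmetric] K1[OF x] trace_def mat2_simps)
        moreover have "bracket (phi_minus \<gamma> P x) M $ 1 $ 2 = ph P 2 x * (M $ 1 $ 1 - M $ 2 $ 2) / 2"
          and "bracket (phi_minus \<gamma> P x) M $ 1 $ 1 = - (ph P 2 x * M $ 2 $ 1 + of_real \<gamma> * M $ 1 $ 2) / 2"
          by (simp_all add: bracket_def phi_minus_def matrix_matrix_mult_def sum_2 field_simps)
        then have "ph P 2 x * (M $ 1 $ 1 - M $ 2 $ 2) = 0"
          and br1: "- (ph P 2 x * M $ 2 $ 1) = of_real \<gamma> * M $ 1 $ 2"
          using br[folded M_def] by simp_all
        ultimately have diag: "M $ 1 $ 1 = 0" "M $ 2 $ 2 = 0"
          using root by auto
        have "proot P x \<noteq> 0"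
          using root by auto
        then have "of_real \<gamma> * M $ 1 $ 2 = ph P 2 x * M $ 2 $ 1"
          using tr1 root(1) by (simp add: field_simps power2_eq_square)
        then have "ph P 2 x * M $ 2 $ 1 + ph P 2 x * M $ 2 $ 1 = 0"
          unfolding br1[symmetric] by (metis add.left_inverse)
        then have "ph P 2 x * M $ 2 $ 1 = 0" "of_real \<gamma> * M $ 1 $ 2 = 0"
          by (simp_all flip: mult_2 br1)
        then show "mat_nth (X x) (int n) = 0"
          using diag root(2) \<gamma> by (simp add: M_def[symmetric] vec_eq_iff forall_2)
      qed
    qed
  qed
  then show ?thesis
    using X(1) x by (intro mat_nth_eqI) (metis int_nat_eq not_le mat_nth_arith(1) regular_def)
qed

section \<open>The canonical formal Killing field along a surface\<close>

lemma mat_nth_killing_matrix: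
  "mat_nth (killing_matrix a b c p) n =
     (if n < 0 then 0
      else if even n then vector [vector [- \<i> * a (nat n + 1) p, 0], vector [0, \<i> * a (nat n + 1) p]]
      else vector [vector [0, 2 * c (nat n + 1) p], vector [2 * b (nat n + 1) p, 0]])"
  by (cases "n < 0")
    (simp_all add: mat2_simps mat_nth_def killing_matrix_def mat22_def Let_def even_nat_iff flip: mult_2)

lemma killing_fieldD:
  assumes "canonical_formal_killing_field \<gamma> a b c"
  shows "\<forall>n. a (2 * n + 1) \<in> z_polynomials"
    and "\<forall>n. \<exists>f\<in>z_polynomials. b (2 * n + 2) = (\<lambda>p. f p / fst p)"
    and "\<forall>n. \<exists>f\<in>z_polynomials. c (2 * n + 2) = (\<lambda>p. f p * fst p)"
    and "\<forall>p\<in>jet_space. a 1 p = 0"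
    and "\<forall>p\<in>jet_space. b 2 p = - \<i> * of_real \<gamma> / fst p"
    and "\<forall>p\<in>jet_space. c 2 p = \<i> * fst p"
    and "\<gamma>\<^sup>2 = \<epsilon> + \<delta>\<^sup>2 \<Longrightarrow> is_cmc_patch \<epsilon> \<delta> P \<Longrightarrow>
      parallel \<gamma> P (\<lambda>x. killing_matrix a b c (patch_jet P x))"
  using assms unfolding canonical_formal_killing_field_def parallel_def
  by - (elim conjE, (assumption | blast))+

lemma killing_field_low_coefficients:
  assumes "canonical_formal_killing_field \<gamma> a b c" and "p \<in> jet_space"
  shows "n < 1 \<Longrightarrow> mat_nth (killing_matrix a b c p) n = 0"
    and "mat_nth (killing_matrix a b c p) 1 =
      vector [vector [0, 2 * \<i> * fst p], vector [- 2 * \<i> * of_real \<gamma> / fst p, 0]]"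
proof -
  have "a 1 p = 0" "b 2 p = - \<i> * of_real \<gamma> / fst p" "c 2 p = \<i> * fst p"
    using killing_fieldD(4-6)[OF assms(1)] assms(2) by auto
  moreover have "n < 1 \<Longrightarrow> n < 0 \<or> n = 0"
    by auto
  ultimately show "n < 1 \<Longrightarrow> mat_nth (killing_matrix a b c p) n = 0"
    and "mat_nth (killing_matrix a b c p) 1 =
      vector [vector [0, 2 * \<i> * fst p], vector [- 2 * \<i> * of_real \<gamma> / fst p, 0]]"
    by (auto simp: mat_nth_killing_matrix vec_eq_iff forall_2 numeral_2_eq_2)
qed

lemma patch_root:
  assumes P: "is_cmc_patch \<epsilon> \<delta> P" and x: "x \<in> pdom P"
  shows "proot P differentiable (at x)" and "proot P x \<noteq> 0"
proof -
  show "proot P differentiable (at x)"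
    using is_cmc_patchD(4)[OF P] x by (rule smooth_on_differentiable)
  have "ph P 2 x \<noteq> 0" and "(proot P x)\<^sup>2 = ph P 2 x"
    using is_cmc_patchD(7)[OF P] x by auto
  then show "proot P x \<noteq> 0"
    by auto
qed

lemma patch_jet_in_jet_space: "is_cmc_patch \<epsilon> \<delta> P \<Longrightarrow> x \<in> pdom P \<Longrightarrow> patch_jet P x \<in> jet_space"
  using patch_root(2) by (simp add: jet_space_def patch_jet_def)

lemma z_polynomial_differentiable:
  assumes P: "is_cmc_patch \<epsilon> \<delta> P" and x: "x \<in> pdom P" and f: "f \<in> z_polynomials"
  shows "(\<lambda>y. f (patch_jet P y)) differentiable (at x)"
  using f
proof induction
  case (var j)
  have "smooth_on (pdom P) (ph P j)"
    using is_cmc_patchD(5)[OF P] var by simp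
  then have "ph P j differentiable (at x)"
    using x by (rule smooth_on_differentiable)
  with patch_root[OF P x] show ?case
    by (simp add: zcoord_def patch_jet_def divide_inverse)
qed auto

lemma killing_matrix_differentiable:
  assumes P: "is_cmc_patch \<epsilon> \<delta> P" and x: "x \<in> pdom P"
    and K: "canonical_formal_killing_field \<gamma> a b c"
  shows "mat_differentiable x (\<lambda>y. killing_matrix a b c (patch_jet P y))"
proof -
  note z = z_polynomial_differentiable[OF P x]
  note s = patch_root[OF P x]
  have a: "(\<lambda>y. a (2 * m + 1) (patch_jet P y)) differentiable (at x)" for m
    using killing_fieldD(1)[OF K] z by blast
  have bc: "(\<lambda>y. b (2 * m + 2) (patch_jet P y)) differentiable (at x)"
    "(\<lambda>y. c (2 * m + 2) (patch_jet P y)) differentiable (at x)" for m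
  proof -
    obtain f where f: "f \<in> z_polynomials" "b (2 * m + 2) = (\<lambda>p. f p / fst p)"
      using killing_fieldD(2)[OF K] by blast
    show "(\<lambda>y. b (2 * m + 2) (patch_jet P y)) differentiable (at x)"
      unfolding f(2) using z[OF f(1)] s by (simp add: patch_jet_def divide_inverse)
    obtain g where g: "g \<in> z_polynomials" "c (2 * m + 2) = (\<lambda>p. g p * fst p)"
      using killing_fieldD(3)[OF K] by blast
    show "(\<lambda>y. c (2 * m + 2) (patch_jet P y)) differentiable (at x)"
      unfolding g(2) using z[OF g(1)] s by (simp add: patch_jet_def)
  qed
  have "killing_matrix a b c p $ i $ j $$ n = mat_nth (killing_matrix a b c p) n $ i $ j" for p i j n
    by (simp add: mat_nth_def)
  moreover have "(\<lambda>y. mat_nth (killing_matrix a b c (patch_jet P y)) n $ i $ j) differentiable (at x)"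
    for i j n
  proof -
    consider "n < 0" | m where "n = int (2 * m)" | m where "n = int (2 * m + 1)"
      by (metis evenE nonneg_int_cases not_le oddE)
    then show ?thesis
    proof cases
      case 1
      then show ?thesis by (simp add: mat_nth_killing_matrix)
    next
      case (2 m)
      then have "\<not> n < 0" "even n" "nat n + 1 = 2 * m + 1" by auto
      then show ?thesis
        using a[of m] exhaust_2[of i] exhaust_2[of j] by (auto simp: mat_nth_killing_matrix simp del: One_nat_def)
    next
      case (3 m)
      then have "\<not> n < 0" "odd n" "nat n + 1 = 2 * m + 2" by auto
      then show ?thesis
        using bc[of m] exhaust_2[of i] exhaust_2[of j] by (auto simp: mat_nth_killing_matrix simp del: One_nat_def)
    qed
  qed
  ultimately show ?thesis
    by (simp add: mat_differentiable_def fls_differentiable_def)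
qed

section \<open>The symmetry of the hierarchy as a commutator\<close>

text \<open>The Laurent polynomial by which \<open>K\<close> is multiplied before truncation: the \<open>i\<close>-th term is the
  factor in the definition of \<open>U\<^sub>i\<close>.\<close>

definition symmetry_symbol :: "nat \<Rightarrow> (nat \<Rightarrow> complex) \<Rightarrow> complex fls" where
  "symmetry_symbol N k =
     (\<Sum>i\<le>N. fls_const (k i / (2 * \<i>)) * fls_X_intpow (- 2 * int i - 2))"

text \<open>The part of nonnegative degree is used because it can be multiplied with \<open>K\<close> as a power
  series; up to sign it gives the same commutator with \<open>K\<close> as the part of negative degree.\<close>

definition symmetry_matrix :: "nat \<Rightarrow> (nat \<Rightarrow> complex) \<Rightarrow> loop_matrix \<Rightarrow> loop_matrix" where
  "symmetry_matrix N k Y = regular_part (scale_mat (symmetry_symbol N k) Y)"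

lemma monomial_times_nth:
  fixes f :: "complex fls"
  shows "(fls_const u * fls_X_intpow m * f) $$ n = u * f $$ (n - m)"
  unfolding mult.assoc by (simp add: fls_X_intpow_times_conv_shift)

lemma symmetry_symbol_times_nth:
  "(symmetry_symbol N k * f) $$ n = (\<Sum>i\<le>N. k i / (2 * \<i>) * f $$ (n + 2 * int i + 2))"
  by (simp only: symmetry_symbol_def sum_distrib_right fls_nth_sum monomial_times_nth)
    (simp add: algebra_simps)

lemma regular_symmetry_matrix: "regular (symmetry_matrix N k Y)"
  by (simp add: symmetry_matrix_def regular_regular_part)

text \<open>The part \<open>U\<close> of negative degree and the symmetry matrix add up to a scalar multiple of \<open>K\<close>,
  which commutes with \<open>K\<close>; so \<open>- [U, K]\<close> is the commutator of the symmetry matrix with \<open>K\<close>.\<close>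

lemma symmetry_killing_matrix:
  assumes dt: "cmc_hierarchy a b c dt" and p: "p \<in> jet_space"
  shows "coeffwise (\<lambda>f. symmetry dt N k f p) (killing_matrix a b c)
    = commutator (symmetry_matrix N k (killing_matrix a b c p)) (killing_matrix a b c p)"
proof -
  define K where "K = killing_matrix a b c p"
  define U where "U = (\<chi> r s. \<Sum>i\<le>N. fls_const (k i) * U_part (killing_matrix a b c) i p $ r $ s)"
  have "coeffwise (\<lambda>f. dt i f p) (killing_matrix a b c) = - commutator (U_part (killing_matrix a b c) i p) K"
    for i
    using dt p by (simp add: cmc_hierarchy_def K_def)
  moreover have "coeffwise (\<lambda>f. symmetry dt N k f p) (killing_matrix a b c) $ r $ s
      = (\<Sum>i\<le>N. fls_const (k i) * coeffwise (\<lambda>f. dt i f p) (killing_matrix a b c) $ r $ s)" for r s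
    by (rule fls_eqI) (simp add: coeffwise_def symmetry_def fls_nth_sum)
  ultimately have "coeffwise (\<lambda>f. symmetry dt N k f p) (killing_matrix a b c) = - commutator U K"
    by (simp add: vec_eq_iff forall_2)
      (simp add: commutator_def mat2_simps U_def sum_distrib_left sum_distrib_right sum.distrib sum_subtractf
        algebra_simps)
  also have "U = scale_mat (symmetry_symbol N k) K - symmetry_matrix N k K"
  proof -
    have "U $ r $ s = (scale_mat (symmetry_symbol N k) K - symmetry_matrix N k K) $ r $ s" for r s
    proof (rule fls_eqI)
      fix n
      have "U_part (killing_matrix a b c) i p $ r $ s $$ n
          = (if n < 0 then K $ r $ s $$ (n + 2 * int i + 2) / (2 * \<i>) else 0)" for i
        unfolding U_part_def fls_negative_part_def K_def
        by (simp only: vec_lambda_beta fls_minus_nth fps_to_fls_nth fls_regpart_nth monomial_times_nth)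
          (simp add: algebra_simps)
      then show "U $ r $ s $$ n = (scale_mat (symmetry_symbol N k) K - symmetry_matrix N k K) $ r $ s $$ n"
        by (simp add: U_def fls_nth_sum scale_mat_def symmetry_matrix_def regular_part_def
            symmetry_symbol_times_nth mult_ac)
    qed
    then show ?thesis by (simp add: vec_eq_iff)
  qed
  finally show ?thesis
    by (simp add: commutator_diff_left commutator_scale_self K_def)
qed

text \<open>This is where the Jacobi field enters: the coefficient of degree \<open>0\<close> comes from the even
  coefficients \<open>2i + 2\<close> of \<open>K\<close>, which are diagonal with entries \<open>\<plusminus> \<i> a\<^bsup>2i+3\<^esup>\<close>.\<close>

lemma mat_nth_symmetry_matrix_0:
  "mat_nth (symmetry_matrix N k (killing_matrix a b c p)) 0 =
     scale_mat ((\<Sum>i\<le>N. k i * a (2 * i + 3) p) / 2) (vector [vector [- 1, 0], vector [0, 1]])"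
proof -
  let ?K = "killing_matrix a b c p"
  have "mat_nth (symmetry_matrix N k ?K) 0 $ r $ s
      = (\<Sum>i\<le>N. k i / (2 * \<i>) * mat_nth ?K (2 * int i + 2) $ r $ s)" for r s
    by (simp add: symmetry_matrix_def mat_nth_regular_part)
      (simp add: mat_nth_def scale_mat_def symmetry_symbol_times_nth)
  moreover have "nat (2 * int i + 2) + 1 = 2 * i + 3" for i
    by simp
  ultimately show ?thesis
    by (simp add: mat_nth_killing_matrix scale_mat_def vec_eq_iff forall_2 sum_divide_distrib sum_negf
        mult_ac numeral_3_eq_3)
qed

text \<open>In degree \<open>1\<close> the commutator of the symmetry matrix with \<open>K\<close> is the bracket of a diagonal
  matrix, a multiple of the Jacobi field, with the off-diagonal invertible matrix \<open>K\<^sub>1\<close>.\<close>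

lemma stationary_imp_jacobi_zero:
  assumes K: "canonical_formal_killing_field \<gamma> a b c" and dt: "cmc_hierarchy a b c dt"
    and p: "p \<in> jet_space"
    and st: "coeffwise (\<lambda>f. symmetry dt N k f p) (killing_matrix a b c) = 0"
  shows "(\<Sum>i\<le>N. k i * a (2 * i + 3) p) = 0"
proof -
  let ?K = "killing_matrix a b c p" and ?Q = "symmetry_matrix N k (killing_matrix a b c p)"
  have "mat_nth (commutator ?Q ?K) (0 + 1) = bracket (mat_nth ?Q 0) (mat_nth ?K 1)"
    by (rule mat_nth_commutator_leading)
      (use regular_symmetry_matrix killing_field_low_coefficients(1)[OF K p] in \<open>auto simp: regular_def\<close>)
  then have "bracket (mat_nth ?Q 0) (mat_nth ?K 1) = 0"
    using st symmetry_killing_matrix[OF dt p, of N k] by simp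
  then have "(\<Sum>i\<le>N. k i * a (2 * i + 3) p) * fst p = 0"
    unfolding killing_field_low_coefficients(2)[OF K p] mat_nth_symmetry_matrix_0
    by (simp add: bracket_def scale_mat_def mat2_simps)
  then show ?thesis
    using p by (simp add: jet_space_def)
qed

text \<open>The untruncated multiple \<open>W\<close> of \<open>K\<close> satisfies the Killing equation. Since \<open>\<phi>\<^sub>\<lambda>\<close> has degrees between \<open>- 1\<close> and \<open>1\<close>,
  truncation can disturb this only in degrees \<open>- 1\<close> and \<open>0\<close>, by the terms
  \<open>[\<phi>\<^sub>-, Q\<^sub>0]\<close>, where \<open>Q\<close> is the truncation, and \<open>[\<phi>\<^sub>+, W\<^sub>-\<^sub>1]\<close>.\<close>

lemma parallel_symmetry_matrix:
  assumes P: "is_cmc_patch \<epsilon> \<delta> P" and par: "parallel \<gamma> P K"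
    and K: "\<And>x. x \<in> pdom P \<Longrightarrow> mat_differentiable x K"
    and zero: "\<And>x. x \<in> pdom P \<Longrightarrow> mat_nth (symmetry_matrix N k (K x)) 0 = 0"
  shows "parallel \<gamma> P (\<lambda>x. symmetry_matrix N k (K x))"
    and "x \<in> pdom P \<Longrightarrow> mat_differentiable x (\<lambda>x. symmetry_matrix N k (K x))"
proof -
  let ?s = "symmetry_symbol N k" and ?Q = "\<lambda>x. symmetry_matrix N k (K x)"
  define w where "w i = k i / (2 * \<i>)" for i
  have Q_nth: "?Q x $ r $ s $$ n = (if n < 0 then 0 else \<Sum>i\<le>N. w i * K x $ r $ s $$ (n + 2 * int i + 2))"
    for x r s n
    by (simp add: symmetry_matrix_def regular_part_def scale_mat_def symmetry_symbol_times_nth w_def)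
  have der: "((\<lambda>x. ?Q x $ r $ s $$ n) has_derivative (\<lambda>v. if n < 0 then 0 else
      \<Sum>i\<le>N. w i * frechet_derivative (\<lambda>y. K y $ r $ s $$ (n + 2 * int i + 2)) (at x) v)) (at x)"
    if "x \<in> pdom P" for x r s n
    using K[OF that] unfolding Q_nth
    by (cases "n < 0") (auto simp: mat_differentiable_def fls_differentiable_def
        intro!: has_derivative_sum has_derivative_mult_right has_derivative_frechet)
  show diff: "mat_differentiable x ?Q" if "x \<in> pdom P" for x
    using der[OF that] by (auto simp: mat_differentiable_def fls_differentiable_def differentiable_def)
  show "parallel \<gamma> P ?Q"
    unfolding parallel_def
  proof (intro ballI allI mat_nth_eqI)
    fix x v n assume x: "x \<in> pdom P"
    let ?W = "scale_mat ?s (K x)"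
    have Q: "mat_nth (?Q y) m = (if m < 0 then 0 else mat_nth (scale_mat ?s (K y)) m)" for y m
      by (simp add: symmetry_matrix_def mat_nth_regular_part)
    have dQ: "mat_nth (deriv_mat x w ?Q) m = (if m < 0 then 0 else - mat_nth (commutator (phi \<gamma> P x w) ?W) m)"
      for w m
    proof -
      have "deriv_mat x w K = - commutator (phi \<gamma> P x w) (K x)"
        using par x by (simp add: parallel_def eq_neg_iff_add_eq_0)
      then have W: "- commutator (phi \<gamma> P x w) ?W = scale_mat ?s (deriv_mat x w K)"
        by (simp add: commutator_scale_right) (simp add: scale_mat_def vec_eq_iff)
      have "mat_nth (deriv_mat x w ?Q) m = (if m < 0 then 0 else mat_nth (scale_mat ?s (deriv_mat x w K)) m)"
        using frechet_derivative_at[OF der[OF x], symmetric, of _ _ m]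
        by (auto simp: vec_eq_iff mat_nth_def deriv_mat_nth deriv_fls_def scale_mat_def
            symmetry_symbol_times_nth w_def)
      then show ?thesis
        by (simp flip: W)
    qed
    \<comment> \<open>As \<open>Q\<^sub>0\<close> vanishes on an open set, degree \<open>0\<close> of the Killing equation reduces to
      \<open>\<xi> [\<phi>\<^sub>-, W\<^sub>1] + \<xi>\<^sup>* [\<phi>\<^sub>+, W\<^sub>-\<^sub>1] = 0\<close>, and \<open>\<xi>\<close>, \<open>\<xi>\<^sup>*\<close> are independent.\<close>
    have plus: "bracket (phi_plus \<gamma> P x) (mat_nth ?W (- 1)) = 0"
    proof -
      have "mat_nth (commutator (phi \<gamma> P x w) ?W) 0 = 0" for w
      proof -
        have "mat_nth (deriv_mat x w ?Q) 0 = 0"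
          using zero
          by (auto simp: mat_nth_def vec_eq_iff deriv_mat_nth deriv_fls_def
              intro!: frechet_derivative_zero_on_open[OF is_cmc_patchD(1)[OF P] x])
        then show ?thesis by (simp add: dQ)
      qed
      then have sum0: "scale_mat (xi P x w) (bracket (phi_minus \<gamma> P x) (mat_nth ?W 1))
          + scale_mat (cnj (xi P x w)) (bracket (phi_plus \<gamma> P x) (mat_nth ?W (- 1))) = 0" for w
        using zero[OF x] by (simp add: mat_nth_commutator_phi Q bracket_def)
      obtain v1 v2 where v: "xi P x v1 = 1" "xi P x v2 = \<i>"
        using xi_surj[OF P x] by metis
      show ?thesis
        using sum0[of v1] sum0[of v2] by (simp add: v scale_mat_def vec_eq_iff)
    qed
    show "mat_nth (deriv_mat x v ?Q + commutator (phi \<gamma> P x v) (?Q x)) n = mat_nth 0 n"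
    proof (cases "n \<ge> 0")
      case True
      then show ?thesis
        using plus by (cases "n = 0") (simp_all add: dQ mat_nth_commutator_phi Q)
    next
      case False
      then have "n + 1 = 0 \<or> n + 1 < 0" by auto
      then show ?thesis
        using False zero[OF x] by (auto simp: dQ mat_nth_commutator_phi Q)
    qed
  qed
qed

text \<open>The symmetry matrix and \<open>K\<close> are both parallel, hence so is their commutator. It vanishes in
  degree \<open>0\<close> because both factors do, and both it and its product with \<open>K\<close> have trace zero; so
  rigidity of parallel matrices applies.\<close>

lemma jacobi_zero_imp_stationary:
  assumes \<gamma>: "\<gamma> \<noteq> 0" "\<gamma>\<^sup>2 = \<epsilon> + \<delta>\<^sup>2" and P: "is_cmc_patch \<epsilon> \<delta> P"
    and K: "canonical_formal_killing_field \<gamma> a b c" and dt: "cmc_hierarchy a b c dt"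
    and zero: "\<And>x. x \<in> pdom P \<Longrightarrow> (\<Sum>i\<le>N. k i * a (2 * i + 3) (patch_jet P x)) = 0"
    and x: "x \<in> pdom P"
  shows "coeffwise (\<lambda>f. symmetry dt N k f (patch_jet P x)) (killing_matrix a b c) = 0"
proof -
  let ?K = "\<lambda>x. killing_matrix a b c (patch_jet P x)"
  let ?Q = "\<lambda>x. symmetry_matrix N k (?K x)"
  let ?X = "\<lambda>x. commutator (?Q x) (?K x)"
  note low = killing_field_low_coefficients[OF K patch_jet_in_jet_space[OF P]]
  have K_par: "parallel \<gamma> P ?K"
    by (rule killing_fieldD(7)[OF K \<gamma>(2) P])
  have K_diff: "mat_differentiable x ?K" if "x \<in> pdom P" for x
    using killing_matrix_differentiable[OF P that K] .
  have K_reg: "regular (?K x)" for x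
    by (simp add: regular_def mat_nth_killing_matrix)
  have Q0: "mat_nth (?Q x) 0 = 0" if "x \<in> pdom P" for x
    by (simp add: mat_nth_symmetry_matrix_0 zero[OF that] scale_mat_def vec_eq_iff)
  note Q = parallel_symmetry_matrix[OF P K_par K_diff Q0]
  have "parallel \<gamma> P ?X"
    by (rule parallel_commutator[OF Q(1) K_par Q(2) K_diff regular_symmetry_matrix K_reg])
  moreover have "mat_nth (?X x) 0 = 0" if "x \<in> pdom P" for x
  proof -
    have "mat_nth (?X x) (0 + 0) = bracket (mat_nth (?Q x) 0) (mat_nth (?K x) 0)"
      by (rule mat_nth_commutator_leading)
        (use regular_symmetry_matrix K_reg in \<open>auto simp: regular_def\<close>)
    then show ?thesis
      by (simp add: Q0[OF that] bracket_def)
  qed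
  ultimately have "?X x = 0"
    by (rule parallel_zero[OF P \<gamma>(1) _ regular_commutator[OF regular_symmetry_matrix K_reg] _
          trace_commutator trace_commutator_mult _ _ x])
      (simp_all add: low, simp add: patch_jet_def)
  then show ?thesis
    by (simp add: symmetry_killing_matrix[OF dt patch_jet_in_jet_space[OF P x]])
qed

section \<open>From patches to surfaces\<close>

lemma surface_patch:
  assumes S: "is_cmc_surface \<epsilon> \<delta> S"
  obtains \<kappa> x where "is_cmc_patch \<epsilon> \<delta> (patch_of S \<kappa>)" "x \<in> pdom (patch_of S \<kappa>)"
    and "patch_jet (patch_of S \<kappa>) x = surface_jet S q"
proof -
  have "smooth_atlas (charts S)" and patch: "\<forall>\<kappa>\<in>charts S. is_cmc_patch \<epsilon> \<delta> (patch_of S \<kappa>)"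
    using S by (auto simp: is_cmc_surface_def)
  then obtain \<kappa> where \<kappa>: "\<kappa> \<in> charts S" "q \<in> fst \<kappa>"
    and "homeomorphism (fst \<kappa>) (snd \<kappa> ` fst \<kappa>) (snd \<kappa>) (chart_inv \<kappa>)"
    unfolding smooth_atlas_def by blast
  then have "chart_inv \<kappa> (snd \<kappa> q) = q"
    by (simp add: homeomorphism_def)
  then show thesis
    using \<kappa> patch by (intro that[of \<kappa> "snd \<kappa> q"]) (auto simp: patch_of_def patch_jet_def surface_jet_def)
qed

lemma patch_jet_patch_of: "patch_jet (patch_of S \<kappa>) x = surface_jet S (chart_inv \<kappa> x)"
  by (simp add: patch_of_def patch_jet_def surface_jet_def)

theorem corollary10p1:
  fixes \<epsilon> \<delta> \<gamma> :: real
    and S :: "'m::{t2_space, second_countable_topology} cmc_surface"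
    and a b c :: "nat \<Rightarrow> jet \<Rightarrow> complex"
    and dt :: "nat \<Rightarrow> jet_operator"
  assumes "\<gamma>\<^sup>2 > 0"
    and "\<gamma>\<^sup>2 = \<epsilon> + \<delta>\<^sup>2"
    and "is_cmc_surface \<epsilon> \<delta> S"
    and "canonical_formal_killing_field \<gamma> a b c"
    and "cmc_hierarchy a b c dt"
  shows "linear_finite_type a S \<longleftrightarrow>
    (\<exists>N k. (\<exists>i\<le>N. k i \<noteq> 0) \<and>
       (\<forall>q. coeffwise (\<lambda>f. symmetry dt N k f (surface_jet S q)) (killing_matrix a b c) = 0))"
proof -
  have \<gamma>: "\<gamma> \<noteq> 0"
    using assms(1) by auto
  have "(\<forall>q. (\<Sum>i\<le>N. k i * a (2 * i + 3) (surface_jet S q)) = 0) \<longleftrightarrow>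
      (\<forall>q. coeffwise (\<lambda>f. symmetry dt N k f (surface_jet S q)) (killing_matrix a b c) = 0)"
    (is "?finite \<longleftrightarrow> ?stationary") for N k
  proof (intro iffI allI)
    fix q assume ?finite
    obtain \<kappa> x where P: "is_cmc_patch \<epsilon> \<delta> (patch_of S \<kappa>)" "x \<in> pdom (patch_of S \<kappa>)"
      and jet: "patch_jet (patch_of S \<kappa>) x = surface_jet S q"
      using surface_patch[OF assms(3)] .
    show "coeffwise (\<lambda>f. symmetry dt N k f (surface_jet S q)) (killing_matrix a b c) = 0"
      using jacobi_zero_imp_stationary[OF \<gamma> assms(2) P(1) assms(4,5) _ P(2), where N = N and k = k] \<open>?finite\<close>
      by (simp add: jet) (simp add: patch_jet_patch_of)
  next
    fix q assume ?stationary
    obtain \<kappa> x where "is_cmc_patch \<epsilon> \<delta> (patch_of S \<kappa>)" "x \<in> pdom (patch_of S \<kappa>)"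
      and "patch_jet (patch_of S \<kappa>) x = surface_jet S q"
      using surface_patch[OF assms(3)] .
    then have "surface_jet S q \<in> jet_space"
      by (metis patch_jet_in_jet_space)
    then show "(\<Sum>i\<le>N. k i * a (2 * i + 3) (surface_jet S q)) = 0"
      using stationary_imp_jacobi_zero[OF assms(4,5), where N = N and k = k] \<open>?stationary\<close> by blast
  qed
  then show ?thesis
    by (simp add: linear_finite_type_def)
qed

end
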